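(* Consider the three-player gambler's ruin process with initial capitals $1$, $1$, and $N-2$ for players 1, 2, and 3, respectively, where $N\ge 3$ is an integer. Then $$P_{1,1,N-2}(\text{player 3 goes broke first})\approx\frac{1}{N^3},$$ that is, there exist constants $c,c'>0$, not depending on $N$, such that for all integers $N\ge3$, $$c\,P_{1,1,N-2}(\text{player 3 goes broke first})\le \frac{1}{N^3}\le c'\,P_{1,1,N-2}(\text{player 3 goes broke first}).$$
   Context: Three-player gambler's ruin: players 1, 2, 3 start with positive integer capitals $A$, $B$, $C$ (in units), respectively. At each round, independently of the past, a pair of players is chosen uniformly at random from the three pairs, and a fair coin flip decides which of the two players in the pair transfers one unit to the other. When a player's capital reaches $0$, that player goes broke (is eliminated), and play continues between the remaining two players, with one unit transferred according to a fair coin flip at each round, until one of them goes broke. $P_{A,B,C}$ denotes probability for this process with initial capitals $A,B,C$. "Player 3 goes broke first" is the event that player 3 is the first of the three players to reach capital $0$. Notation: for positive sequences, $a_N\approx b_N$ means there exist positive universal constants $c$ and $c'$ such that $c\,a_N\le b_N\le c'a_N$ for all $N$. *)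

theory Defs
  imports "HOL-Probability.Probability"
begin

datatype player = Player1 | Player2 | Player3

instance player :: countable
  by countable_datatype

type_synonym capitals = "player \<Rightarrow> nat"

text \<open>The randomness of a single round: the pair chosen, and the coin flip.\<close>

type_synonym round_outcome = "(player \<times> player) \<times> bool"

definition round_pmf :: "round_outcome pmf" where
  "round_pmf = pair_pmf
     (pmf_of_set {(Player1, Player2), (Player1, Player3), (Player2, Player3)})
     (bernoulli_pmf (1/2))"

definition transfer :: "player \<Rightarrow> player \<Rightarrow> capitals \<Rightarrow> capitals" where
  "transfer p q s = s(p := s p - 1, q := s q + 1)"

text \<open>Once a player is broke, the chosen pair is ignored and the two remaining players play.\<close>

definition competing_pair :: "capitals \<Rightarrow> player \<times> player \<Rightarrow> player \<times> player" where
  "competing_pair s e =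
     (if s Player1 = 0 then (Player2, Player3)
      else if s Player2 = 0 then (Player1, Player3)
      else if s Player3 = 0 then (Player1, Player2)
      else e)"

text \<open>The game is over, and the capitals are frozen, when fewer than two players have money left.\<close>

definition play_round :: "capitals \<Rightarrow> round_outcome \<Rightarrow> capitals" where
  "play_round s r =
     (if card {p. s p > 0} < 2 then s
      else case competing_pair s (fst r) of
        (p, q) \<Rightarrow> if snd r then transfer p q s else transfer q p s)"

definition initial_capitals :: "nat \<Rightarrow> nat \<Rightarrow> nat \<Rightarrow> capitals" where
  "initial_capitals A B C = (\<lambda>p. case p of Player1 \<Rightarrow> A | Player2 \<Rightarrow> B | Player3 \<Rightarrow> C)"

definition capitals_after :: "capitals \<Rightarrow> round_outcome stream \<Rightarrow> nat \<Rightarrow> capitals" where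
  "capitals_after s \<omega> n = foldl play_round s (stake n \<omega>)"

definition goes_broke_first :: "player \<Rightarrow> capitals \<Rightarrow> round_outcome stream \<Rightarrow> bool" where
  "goes_broke_first p s \<omega> \<longleftrightarrow>
     (\<exists>n. capitals_after s \<omega> n p = 0 \<and>
          (\<forall>q. q \<noteq> p \<longrightarrow> (\<forall>m\<le>n. capitals_after s \<omega> m q > 0)))"

definition ruin_prob :: "nat \<Rightarrow> nat \<Rightarrow> nat \<Rightarrow> (capitals \<Rightarrow> round_outcome stream \<Rightarrow> bool) \<Rightarrow> real" where
  "ruin_prob A B C E =
     measure (stream_space (measure_pmf round_pmf)) {\<omega>. E (initial_capitals A B C) \<omega>}"

text \<open>The measure of a non-measurable set would be zero by convention; this event is measurable.\<close>

lemma goes_broke_first_measurable: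
  "{\<omega>. goes_broke_first p s \<omega>} \<in> sets (stream_space (measure_pmf round_pmf))"
proof -
  let ?M = "stream_space (measure_pmf round_pmf)"
  have S: "sets ?M = sets (stream_space (count_space UNIV))"
    by (rule sets_stream_space_cong) simp
  have m: "(\<lambda>\<omega>. capitals_after s \<omega> n) \<in> measurable ?M (count_space UNIV)" for n
    unfolding capitals_after_def measurable_cong_sets[OF S refl]
    by (rule measurable_compose[OF measurable_stake]) simp
  have k: "Measurable.pred ?M (\<lambda>\<omega>. P (capitals_after s \<omega> n))" for P n
    by (rule measurable_compose[OF m]) simp
  have "Measurable.pred ?M (goes_broke_first p s)"
    unfolding goes_broke_first_def
    by (intro pred_intros_countable pred_intros_logic k[where P = "\<lambda>t. t _ = 0"]
        k[where P = "\<lambda>t. t _ > 0"]) simp_all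
  then show ?thesis
    by (simp add: pred_def space_stream_space)
qed

end

theory Submission imports Defs begin

text \<open>
  Let \<open>a\<close> and \<open>b\<close> be the capitals of players 1 and 2. The probability \<open>h a b\<close> that player 3 goes
  broke first is harmonic on the triangular lattice inside \<open>a, b > 0\<close>, \<open>a + b < N\<close>; so is
  \<open>f = a b (a + b)\<close>, which vanishes on the sides \<open>a = 0\<close> and \<open>b = 0\<close>.
  As \<open>f \<le> N^3 / 4\<close> on the side \<open>a + b = N\<close>, the maximum principle gives \<open>h \<ge> 4 f / N^3\<close>.
  For the upper bound let \<open>M \<approx> N / 2\<close>. The harmonic barrier \<open>4 ((a + b - M)^2 - a^2 + N a) / N^2\<close>
  dominates \<open>h\<close>, so on the line \<open>a + b = M\<close> we have \<open>h \<le> 4 a / N\<close>, and \<open>h \<le> 4 b / N\<close> by symmetry.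
  Hence \<open>h\<close> is at most a constant times \<open>f / N^3\<close> on that line, and so at \<open>(1, 1)\<close> as well.
\<close>

section \<open>Maximum principle on the triangular lattice\<close>

definition neighbour_sum :: "(nat \<Rightarrow> nat \<Rightarrow> real) \<Rightarrow> nat \<Rightarrow> nat \<Rightarrow> real" where
  "neighbour_sum u a b =
     u (a - 1) (b + 1) + u (a + 1) (b - 1) + u (a - 1) b + u (a + 1) b + u a (b - 1) + u a (b + 1)"

text \<open>At an interior maximum point the six neighbours are each at most the maximum
  \<open>m\<close> and sum to at least \<open>6 * m\<close>, so all of them equal \<open>m\<close>.
  Passing to the neighbour with smaller first coordinate keeps the value and must eventually reach
  the boundary, where \<open>u\<close> is at most 0.\<close>

lemma maximum_principle:
  fixes u :: "nat \<Rightarrow> nat \<Rightarrow> real"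
  assumes subharmonic: "\<And>a b. 0 < a \<Longrightarrow> 0 < b \<Longrightarrow> a + b < M \<Longrightarrow> 6 * u a b \<le> neighbour_sum u a b"
    and left: "\<And>b. b \<le> M \<Longrightarrow> u 0 b \<le> 0"
    and right: "\<And>a. a \<le> M \<Longrightarrow> u a 0 \<le> 0"
    and far: "\<And>a b. 0 < a \<Longrightarrow> 0 < b \<Longrightarrow> a + b = M \<Longrightarrow> u a b \<le> 0"
    and "a + b \<le> M"
  shows "u a b \<le> 0"
proof -
  let ?T = "{(a, b). a + b \<le> M}"
  have "?T \<subseteq> {..M} \<times> {..M}" by auto
  then have fin: "finite ?T" by (rule finite_subset) simp
  define m where "m = Max (case_prod u ` ?T)"
  have le: "u a b \<le> m" if "a + b \<le> M" for a b
    unfolding m_def using fin that by (intro Max_ge) force+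
  have "m \<in> case_prod u ` ?T"
    unfolding m_def using fin \<open>a + b \<le> M\<close> by (intro Max_in) auto
  then obtain x y where xy: "x + y \<le> M" "u x y = m" by auto
  have "m \<le> 0" if "x + y \<le> M" "u x y = m" for x y
    using that
  proof (induction x arbitrary: y)
    case 0
    then show ?case using left[of y] by simp
  next
    case (Suc x)
    show ?case
    proof (cases "y = 0 \<or> Suc x + y = M")
      case True
      then show ?thesis using Suc.prems right[of "Suc x"] far[of "Suc x" y] by auto
    next
      case False
      then have y: "0 < y" "Suc x + y < M" using Suc.prems by auto
      have "6 * m \<le> neighbour_sum u (Suc x) y"
        using subharmonic[of "Suc x" y] y Suc.prems by simp
      moreover have "u (x + 2) (y - 1) \<le> m" "u x (y + 1) \<le> m" "u (x + 2) y \<le> m"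
          "u (Suc x) (y - 1) \<le> m" "u (Suc x) (y + 1) \<le> m" "u x y \<le> m"
        using y by (auto intro!: le)
      ultimately have "u x y = m" by (simp add: neighbour_sum_def)
      with y show ?thesis by (intro Suc.IH[of y]) auto
    qed
  qed
  with xy le[OF \<open>a + b \<le> M\<close>] show ?thesis by force
qed

section \<open>Linearity of the neighbour sum and two harmonic polynomials\<close>

lemma neighbour_sum_diff:
  "neighbour_sum (\<lambda>a b. u a b - v a b) a b = neighbour_sum u a b - neighbour_sum v a b"
  by (simp add: neighbour_sum_def)

lemma neighbour_sum_cmult: "neighbour_sum (\<lambda>a b. k * u a b) a b = k * neighbour_sum u a b"
  by (simp add: neighbour_sum_def algebra_simps)

lemma neighbour_sum_swap: "neighbour_sum (\<lambda>a b. u b a) a b = neighbour_sum u b a"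
  by (simp add: neighbour_sum_def)

text \<open>In coordinates where the six neighbours form a regular hexagon, the wedge
  \<open>a, b > 0\<close> has angle 60 degrees, and this is a multiple of Im z^3, which vanishes on
  both sides of the wedge.\<close>

definition cubic :: "nat \<Rightarrow> nat \<Rightarrow> real" where
  "cubic a b = real a * real b * (real a + real b)"

text \<open>Each of the two squares exceeds six times itself by 4 under
  \<open>neighbour_sum\<close>, so their difference is harmonic. The linear term makes up for the
  negative square as long as \<open>a <= N\<close>. The first square vanishes on the line
  \<open>a + b = M\<close> and is large on \<open>a + b = N\<close>.\<close>

definition barrier :: "nat \<Rightarrow> nat \<Rightarrow> nat \<Rightarrow> nat \<Rightarrow> real" where
  "barrier N M a b = (real a + real b - real M)\<^sup>2 - (real a)\<^sup>2 + real N * real a"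

lemma cubic_harmonic:
  assumes "0 < a" "0 < b"
  shows "neighbour_sum cubic a b = 6 * cubic a b"
  using assms by (simp add: neighbour_sum_def cubic_def of_nat_diff algebra_simps)

lemma barrier_harmonic:
  assumes "0 < a" "0 < b"
  shows "neighbour_sum (barrier N M) a b = 6 * barrier N M a b"
  using assms
  by (simp add: neighbour_sum_def barrier_def of_nat_diff algebra_simps power2_eq_square)

lemma barrier_nonneg:
  assumes "a \<le> N"
  shows "0 \<le> barrier N M a b"
proof -
  have "(real a)\<^sup>2 \<le> real N * real a"
    using assms by (simp add: power2_eq_square mult_right_mono)
  then show ?thesis
    using zero_le_power2[of "real a + real b - real M"] unfolding barrier_def by linarith
qed

section \<open>Conditioning on the first round\<close>

lemma round_pmf_eq:
  "round_pmf = pmf_of_set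
     ({(Player1, Player2), (Player1, Player3), (Player2, Player3)} \<times> UNIV)"
proof (rule pmf_eqI)
  fix r :: round_outcome
  obtain e c where r: "r = (e, c)" by (cases r)
  have "card ({(Player1, Player2), (Player1, Player3), (Player2, Player3)} \<times> (UNIV :: bool set)) = 6"
    by (simp add: card_cartesian_product)
  then show "pmf round_pmf r = pmf (pmf_of_set
     ({(Player1, Player2), (Player1, Player3), (Player2, Player3)} \<times> UNIV)) r"
    unfolding r round_pmf_def pmf_pair
    by (subst (1 2) pmf_of_set) (auto simp: indicator_def)
qed

lemma expectation_round_pmf:
  fixes g :: "round_outcome \<Rightarrow> real"
  shows "measure_pmf.expectation round_pmf g =
    (g ((Player1, Player2), True) + g ((Player1, Player2), False)
     + g ((Player1, Player3), True) + g ((Player1, Player3), False)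
     + g ((Player2, Player3), True) + g ((Player2, Player3), False)) / 6"
  unfolding round_pmf_eq
  by (subst integral_pmf_of_set)
     (auto simp: UNIV_bool insert_Times_insert card_insert_if)

interpretation rounds: prob_space "stream_space (measure_pmf round_pmf)"
  by (rule prob_space.prob_space_stream_space[OF prob_space_measure_pmf])

lemma measure_stream_space_pmf:
  assumes "X \<in> sets (stream_space (measure_pmf p))"
  shows "measure (stream_space (measure_pmf p)) X =
    measure_pmf.expectation p (\<lambda>x. measure (stream_space (measure_pmf p)) {\<omega>. x ## \<omega> \<in> X})"
proof -
  let ?S = "stream_space (measure_pmf p)"
  interpret S: prob_space ?S by (rule prob_space.prob_space_stream_space[OF prob_space_measure_pmf])
  have "ennreal (measure ?S X) = (\<integral>\<^sup>+x. measure ?S {\<omega>. x ## \<omega> \<in> X} \<partial>p)"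
    using prob_space.emeasure_stream_space[OF prob_space_measure_pmf assms]
    by (simp add: S.emeasure_eq_measure space_stream_space)
  also have "\<dots> = ennreal (measure_pmf.expectation p (\<lambda>x. measure ?S {\<omega>. x ## \<omega> \<in> X}))"
    by (intro nn_integral_eq_integral measure_pmf.integrable_const_bound[where B = 1]) auto
  finally show ?thesis
    by (simp add: integral_nonneg_AE)
qed

lemma capitals_after_0 [simp]: "capitals_after s \<omega> 0 = s"
  by (simp add: capitals_after_def)

lemma capitals_after_Suc [simp]:
  "capitals_after s (r ## \<omega>) (Suc n) = capitals_after (play_round s r) \<omega> n"
  by (simp add: capitals_after_def)

text \<open>While everyone has money, time 0 neither witnesses the event nor violates its condition
  on the other players, so the witness time just shifts by one.\<close>

lemma goes_broke_first_Stream: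
  assumes "\<And>q. 0 < s q"
  shows "goes_broke_first p s (r ## \<omega>) \<longleftrightarrow> goes_broke_first p (play_round s r) \<omega>"
    (is "?L \<longleftrightarrow> ?R")
proof
  assume ?L
  then obtain n where n: "capitals_after s (r ## \<omega>) n p = 0"
      "\<And>q m. q \<noteq> p \<Longrightarrow> m \<le> n \<Longrightarrow> 0 < capitals_after s (r ## \<omega>) m q"
    unfolding goes_broke_first_def by blast
  obtain k where k: "n = Suc k"
    using n(1) assms[of p] by (cases n) auto
  have "0 < capitals_after (play_round s r) \<omega> m q" if "q \<noteq> p" "m \<le> k" for q m
    using n(2)[of q "Suc m"] that k by simp
  with n(1) k show ?R unfolding goes_broke_first_def by auto
next
  assume ?R
  then obtain n where n: "capitals_after (play_round s r) \<omega> n p = 0"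
      "\<And>q m. q \<noteq> p \<Longrightarrow> m \<le> n \<Longrightarrow> 0 < capitals_after (play_round s r) \<omega> m q"
    unfolding goes_broke_first_def by blast
  have "0 < capitals_after s (r ## \<omega>) m q" if "q \<noteq> p" "m \<le> Suc n" for q m
    using that n(2)[of q] assms[of q] by (cases m) auto
  with n(1) show ?L
    unfolding goes_broke_first_def by (intro exI[of _ "Suc n"]) auto
qed

lemma player_UNIV: "(UNIV :: player set) = {Player1, Player2, Player3}"
  using player.exhaust by auto

lemma play_round_initial_capitals:
  assumes "0 < A" "0 < B" "0 < C"
  defines "s \<equiv> initial_capitals A B C"
  shows "play_round s ((Player1, Player2), True) = initial_capitals (A - 1) (B + 1) C"
    "play_round s ((Player1, Player2), False) = initial_capitals (A + 1) (B - 1) C"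
    "play_round s ((Player1, Player3), True) = initial_capitals (A - 1) B (C + 1)"
    "play_round s ((Player1, Player3), False) = initial_capitals (A + 1) B (C - 1)"
    "play_round s ((Player2, Player3), True) = initial_capitals A (B - 1) (C + 1)"
    "play_round s ((Player2, Player3), False) = initial_capitals A (B + 1) (C - 1)"
proof -
  have "{p. 0 < s p} = UNIV"
    using assms by (auto simp: initial_capitals_def split: player.split)
  \<comment> \<open>With three positive capitals the game is not frozen and the drawn pair is the
    one that plays.\<close>
  then have "card {p. 0 < s p} = 3" by (simp add: player_UNIV)
  moreover have "competing_pair s e = e" for e
    using assms by (simp add: competing_pair_def initial_capitals_def)
  ultimately have *: "play_round s ((p, q), c) = (if c then transfer p q s else transfer q p s)" for p q c
    by (simp add: play_round_def)
  show "play_round s ((Player1, Player2), True) = initial_capitals (A - 1) (B + 1) C"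
    "play_round s ((Player1, Player2), False) = initial_capitals (A + 1) (B - 1) C"
    "play_round s ((Player1, Player3), True) = initial_capitals (A - 1) B (C + 1)"
    "play_round s ((Player1, Player3), False) = initial_capitals (A + 1) B (C - 1)"
    "play_round s ((Player2, Player3), True) = initial_capitals A (B - 1) (C + 1)"
    "play_round s ((Player2, Player3), False) = initial_capitals A (B + 1) (C - 1)"
    unfolding * by (auto simp: transfer_def s_def initial_capitals_def fun_eq_iff split: player.split)
qed

lemma ruin_prob_first_step:
  fixes p :: player
  assumes "0 < A" "0 < B" "0 < C"
  defines "R \<equiv> \<lambda>A B C. ruin_prob A B C (goes_broke_first p)"
  shows "6 * R A B C =
    R (A - 1) (B + 1) C + R (A + 1) (B - 1) C + R (A - 1) B (C + 1)
    + R (A + 1) B (C - 1) + R A (B - 1) (C + 1) + R A (B + 1) (C - 1)"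
proof -
  have pos: "0 < initial_capitals A B C q" for q
    using assms by (simp add: initial_capitals_def split: player.split)
  have "R A B C = measure_pmf.expectation round_pmf (\<lambda>r. measure (stream_space round_pmf)
      {\<omega>. goes_broke_first p (play_round (initial_capitals A B C) r) \<omega>})"
    unfolding R_def ruin_prob_def
    by (subst measure_stream_space_pmf[OF goes_broke_first_measurable]) (simp add: goes_broke_first_Stream[OF pos])
  also have "6 * \<dots> = R (A - 1) (B + 1) C + R (A + 1) (B - 1) C + R (A - 1) B (C + 1)
    + R (A + 1) B (C - 1) + R A (B - 1) (C + 1) + R A (B + 1) (C - 1)"
    unfolding expectation_round_pmf play_round_initial_capitals[OF assms(1-3)]
    by (simp add: R_def ruin_prob_def)
  finally show ?thesis .
qed

section \<open>Boundary values and reduction to two coordinates\<close>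

lemma ruin_prob_nonneg: "0 \<le> ruin_prob A B C E"
  by (simp add: ruin_prob_def)

lemma ruin_prob_le_1: "ruin_prob A B C E \<le> 1"
  by (simp add: ruin_prob_def)

lemma ruin_prob_broke_already:
  assumes "0 < A" "0 < B"
  shows "ruin_prob A B 0 (goes_broke_first Player3) = 1"
proof -
  have "goes_broke_first Player3 (initial_capitals A B 0) \<omega>" for \<omega>
    unfolding goes_broke_first_def using assms
    \<comment> \<open>Time 0 is the witness.\<close>
    by (intro exI[of _ 0]) (auto simp: initial_capitals_def split: player.split)
  then show ?thesis
    using rounds.prob_space by (simp add: ruin_prob_def space_stream_space)
qed

lemma ruin_prob_other_broke:
  assumes "A = 0 \<or> B = 0"
  shows "ruin_prob A B C (goes_broke_first Player3) = 0"
proof -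
  obtain q where q: "q \<noteq> Player3" "initial_capitals A B C q = 0"
    using assms by (auto simp: initial_capitals_def intro: that[of Player1] that[of Player2])
  have "\<not> goes_broke_first Player3 (initial_capitals A B C) \<omega>" for \<omega>
    unfolding goes_broke_first_def using q
    by (metis capitals_after_0 le0 less_irrefl)
  then show ?thesis by (simp add: ruin_prob_def)
qed

text \<open>The total capital \<open>N\<close> is conserved, so two coordinates determine the state.
  The six outcomes of a round then become the six lattice neighbours, and the first-step equation
  becomes harmonicity.\<close>

definition third_ruined :: "nat \<Rightarrow> nat \<Rightarrow> nat \<Rightarrow> real" where
  "third_ruined N a b = ruin_prob a b (N - a - b) (goes_broke_first Player3)"

lemma third_ruined_harmonic:
  assumes "0 < a" "0 < b" "a + b < N"
  shows "neighbour_sum (third_ruined N) a b = 6 * third_ruined N a b"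
proof -
  have "N - a - b > 0" using assms by simp
  moreover have "N - (a - 1) - (b + 1) = N - a - b" "N - (a + 1) - (b - 1) = N - a - b"
      "N - (a - 1) - b = N - a - b + 1" "N - (a + 1) - b = N - a - b - 1"
      "N - a - (b - 1) = N - a - b + 1" "N - a - (b + 1) = N - a - b - 1"
    using assms by auto
  ultimately show ?thesis
    unfolding neighbour_sum_def third_ruined_def
    using ruin_prob_first_step[of a b "N - a - b" Player3] assms by simp
qed

lemma third_ruined_bounds: "0 \<le> third_ruined N a b" "third_ruined N a b \<le> 1"
  by (simp_all add: third_ruined_def ruin_prob_nonneg ruin_prob_le_1)

lemma third_ruined_sides [simp]: "third_ruined N 0 b = 0" "third_ruined N a 0 = 0"
  by (simp_all add: third_ruined_def ruin_prob_other_broke)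

lemma third_ruined_far:
  assumes "0 < a" "0 < b" "a + b = N"
  shows "third_ruined N a b = 1"
proof -
  have "N - a - b = 0" using assms by simp
  then show ?thesis using assms by (simp add: third_ruined_def ruin_prob_broke_already)
qed

section \<open>Comparison bounds from the maximum principle\<close>

lemma third_ruined_lower:
  assumes "0 < N" "a + b \<le> N"
  shows "4 / real N ^ 3 * cubic a b \<le> third_ruined N a b"
proof -
  have "4 / real N ^ 3 * cubic a b - third_ruined N a b \<le> 0"
  proof (rule maximum_principle[where M = N])
    fix a b :: nat assume ab: "0 < a" "0 < b" "a + b < N"
    show "6 * (4 / real N ^ 3 * cubic a b - third_ruined N a b) \<le>
        neighbour_sum (\<lambda>a b. 4 / real N ^ 3 * cubic a b - third_ruined N a b) a b"
      unfolding neighbour_sum_diff neighbour_sum_cmult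
      by (simp add: ab cubic_harmonic third_ruined_harmonic)
  next
    fix a b :: nat assume ab: "0 < a" "0 < b" "a + b = N"
    \<comment> \<open>By the AM-GM inequality, \<open>cubic\<close> is at most N^3 / 4 on the far
      side; this is the source of the factor 4.\<close>
    have "4 * (real a * real b) \<le> (real a + real b)\<^sup>2"
      using zero_le_power2[of "real a - real b"] by (simp add: power2_eq_square algebra_simps)
    then have "4 * (real a * real b) * real N \<le> (real N)\<^sup>2 * real N"
      using ab by (intro mult_right_mono) auto
    then have "4 * cubic a b \<le> real N ^ 3"
      using ab by (simp add: cubic_def power2_eq_square power3_eq_cube flip: of_nat_add)
    then show "4 / real N ^ 3 * cubic a b - third_ruined N a b \<le> 0"
      using ab by (simp add: third_ruined_far)
  qed (use assms in \<open>simp_all add: cubic_def third_ruined_bounds\<close>)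
  then show ?thesis by simp
qed

text \<open>On the far side, \<open>2 * M <= N\<close> gives \<open>a + b - M >= N / 2\<close>, so
  the scaled barrier is at least 1 there; on the other two sides it is nonnegative. The two versions
  are useful near different sides of the wedge.\<close>

lemma third_ruined_le_barrier:
  assumes "2 * M \<le> N" "0 < N" "a + b \<le> N"
  shows "third_ruined N a b \<le> 4 / (real N)\<^sup>2 * barrier N M a b"
    and "third_ruined N a b \<le> 4 / (real N)\<^sup>2 * barrier N M b a"
proof -
  have far: "1 \<le> 4 / (real N)\<^sup>2 * barrier N M a b" if "a + b = N" for a b
  proof -
    have "(real N / 2)\<^sup>2 \<le> (real a + real b - real M)\<^sup>2"
      using assms that by (intro power_mono) auto
    moreover have "(real a)\<^sup>2 \<le> real N * real a"
      using that by (simp add: power2_eq_square mult_right_mono)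
    ultimately have "(real N)\<^sup>2 \<le> 4 * barrier N M a b"
      by (simp add: barrier_def power_divide)
    then show ?thesis using assms by (simp add: field_simps)
  qed
  have "third_ruined N a b - 4 / (real N)\<^sup>2 * barrier N M a b \<le> 0"
  proof (rule maximum_principle[where M = N])
    fix a b :: nat assume ab: "0 < a" "0 < b" "a + b < N"
    show "6 * (third_ruined N a b - 4 / (real N)\<^sup>2 * barrier N M a b) \<le>
        neighbour_sum (\<lambda>a b. third_ruined N a b - 4 / (real N)\<^sup>2 * barrier N M a b) a b"
      unfolding neighbour_sum_diff neighbour_sum_cmult
      by (simp add: ab barrier_harmonic third_ruined_harmonic)
  qed (use assms far third_ruined_far in \<open>simp_all add: barrier_nonneg\<close>)
  then show "third_ruined N a b \<le> 4 / (real N)\<^sup>2 * barrier N M a b" by simp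
  \<comment> \<open>The barrier is reflected, and remains harmonic, so no symmetry of the game
    between players 1 and 2 has to be established.\<close>
  have "third_ruined N a b - 4 / (real N)\<^sup>2 * barrier N M b a \<le> 0"
  proof (rule maximum_principle[where M = N
      and u = "\<lambda>a b. third_ruined N a b - 4 / (real N)\<^sup>2 * barrier N M b a"])
    fix a b :: nat assume ab: "0 < a" "0 < b" "a + b < N"
    show "6 * (third_ruined N a b - 4 / (real N)\<^sup>2 * barrier N M b a) \<le>
        neighbour_sum (\<lambda>a b. third_ruined N a b - 4 / (real N)\<^sup>2 * barrier N M b a) a b"
      unfolding neighbour_sum_diff neighbour_sum_cmult
      unfolding neighbour_sum_swap[of "barrier N M"]
      by (simp add: ab barrier_harmonic third_ruined_harmonic)
  qed (use assms far third_ruined_far in \<open>simp_all add: barrier_nonneg add.commute\<close>)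
  then show "third_ruined N a b \<le> 4 / (real N)\<^sup>2 * barrier N M b a" by simp
qed

text \<open>On this line the square in the barrier vanishes, leaving the bounds 4a/N and 4b/N. The
  larger of \<open>a\<close> and \<open>b\<close> is at least M/2, so the smaller is at most 2ab/M,
  and here ab equals \<open>cubic a b\<close> divided by M.\<close>

lemma third_ruined_middle:
  assumes "2 * M \<le> N" "0 < M" "a + b = M"
  shows "third_ruined N a b \<le> 8 / ((real M)\<^sup>2 * real N) * cubic a b"
proof -
  have N: "0 < N" using assms by simp
  have lin: "4 / (real N)\<^sup>2 * barrier N M x y \<le> 4 * real x / real N" if "x + y = M" for x y
  proof -
    have "barrier N M x y \<le> real N * real x"
      using that by (simp add: barrier_def flip: of_nat_add)
    then show ?thesis using N by (simp add: field_simps power2_eq_square)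
  qed
  have min: "real x \<le> 2 * (real x * real y) / real M" if "x + y = M" "x \<le> y" for x y
  proof -
    have "real x * real M \<le> real x * (2 * real y)"
      using that by (intro mult_left_mono) auto
    then show ?thesis using assms by (simp add: field_simps)
  qed
  have "third_ruined N a b \<le> 4 * (2 * (real a * real b) / real M) / real N"
  proof (cases "a \<le> b")
    case True
    have "third_ruined N a b \<le> 4 * real a / real N"
      using third_ruined_le_barrier(1)[of M N a b] lin[of a b] assms N by simp
    also have "\<dots> \<le> 4 * (2 * (real a * real b) / real M) / real N"
      using min[of a b] True assms by (intro divide_right_mono mult_left_mono) auto
    finally show ?thesis .
  next
    case False
    have "third_ruined N a b \<le> 4 * real b / real N"
      using third_ruined_le_barrier(2)[of M N a b] lin[of b a] assms N by simp
    also have "\<dots> \<le> 4 * (2 * (real b * real a) / real M) / real N"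
      using min[of b a] False assms by (intro divide_right_mono mult_left_mono) auto
    finally show ?thesis by (simp add: mult.commute)
  qed
  also have "\<dots> = 8 / ((real M)\<^sup>2 * real N) * cubic a b"
    using assms N by (simp add: cubic_def field_simps power2_eq_square flip: of_nat_add)
  finally show ?thesis .
qed

text \<open>The bound on the line \<open>a + b = M\<close> is carried inward, since both sides are
  harmonic and vanish on the axes. With \<open>M\<close> of order \<open>N\<close> the coefficient
  of \<open>cubic\<close> has order N^-3.\<close>

lemma third_ruined_upper:
  assumes "2 * M \<le> N" "0 < M" "a + b \<le> M"
  shows "third_ruined N a b \<le> 8 / ((real M)\<^sup>2 * real N) * cubic a b"
proof -
  have "third_ruined N a b - 8 / ((real M)\<^sup>2 * real N) * cubic a b \<le> 0"
  proof (rule maximum_principle[where M = M])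
    fix a b :: nat assume ab: "0 < a" "0 < b" "a + b < M"
    with assms have "a + b < N" by simp
    then show "6 * (third_ruined N a b - 8 / ((real M)\<^sup>2 * real N) * cubic a b) \<le>
        neighbour_sum (\<lambda>a b. third_ruined N a b - 8 / ((real M)\<^sup>2 * real N) * cubic a b) a b"
      unfolding neighbour_sum_diff neighbour_sum_cmult
      by (simp add: ab cubic_harmonic third_ruined_harmonic)
  qed (use assms third_ruined_middle in \<open>simp_all add: cubic_def\<close>)
  then show ?thesis by simp
qed

theorem theorem2p5:
  "\<exists>c > (0 :: real). \<exists>c' > (0 :: real). \<forall>N :: nat. N \<ge> 3 \<longrightarrow>
     c * ruin_prob 1 1 (N - 2) (goes_broke_first Player3) \<le> 1 / real N ^ 3 \<and>
     1 / real N ^ 3 \<le> c' * ruin_prob 1 1 (N - 2) (goes_broke_first Player3)"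
proof (intro exI conjI allI impI)
  fix N :: nat assume N: "N \<ge> 3"
  have eq: "ruin_prob 1 1 (N - 2) (goes_broke_first Player3) = third_ruined N 1 1"
    using N by (simp add: third_ruined_def numeral_2_eq_2)
  \<comment> \<open>As \<open>cubic 1 1 = 2\<close>, the left side is 8 / N^3, whence the constant
    1/8.\<close>
  have "4 / real N ^ 3 * cubic 1 1 \<le> third_ruined N 1 1"
    using N by (intro third_ruined_lower) auto
  then show "1 / real N ^ 3 \<le> 1 / 8 * ruin_prob 1 1 (N - 2) (goes_broke_first Player3)"
    unfolding eq by (simp add: cubic_def)
  show "1 / 144 * ruin_prob 1 1 (N - 2) (goes_broke_first Player3) \<le> 1 / real N ^ 3"
  \<comment> \<open>For \<open>N = 3\<close> half of \<open>N\<close> rounds down to 1, and (1, 1)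
    lies outside the triangle \<open>a + b <= M\<close>; the trivial bound 1 suffices, as 1/144 is
    below 1/27.\<close>
  proof (cases "N = 3")
    case True
    then show ?thesis
      unfolding eq using third_ruined_bounds(2)[of N 1 1] by simp
  next
    case False
    define M where "M = N div 2"
    \<comment> \<open>Rounding down gives \<open>N <= 2 * M + 1\<close>, hence
      \<open>N <= 3 * M\<close>. Replacing \<open>M\<close> by N/3 costs a factor 9, and 8 * 9 * 2 =
      144.\<close>
    have M: "2 * M \<le> N" "0 < M" "1 + 1 \<le> M" "N \<le> 3 * M"
      using N False by (auto simp: M_def)
    have "third_ruined N 1 1 \<le> 8 / ((real M)\<^sup>2 * real N) * cubic 1 1"
      by (rule third_ruined_upper) (use M in auto)
    also have "\<dots> \<le> 8 / ((real N / 3)\<^sup>2 * real N) * cubic 1 1"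
      using M N by (intro mult_right_mono divide_left_mono mult_pos_pos power_mono)
        (auto simp: cubic_def)
    also have "\<dots> = 144 / real N ^ 3"
      by (simp add: cubic_def power2_eq_square power3_eq_cube)
    finally show ?thesis unfolding eq by simp
  qed
qed auto

end
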